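(* Let $A:\mathbb{R}\to\mathbb{R}^{n\times n}$ be continuous and bounded, and suppose the linear system $x'=A(t)x$ admits an algebraic dichotomy with respect to a growth rate $\mu$, with projections $P(s)$, $Q(s)=I-P(s)$ and constants $K>0$, $\alpha>0$. Let $f:\mathbb{R}\times\mathbb{R}^n\to\mathbb{R}^n$ be continuous and suppose there are constants $\beta,\gamma\ge 0$ such that for all $t\in\mathbb{R}$ and $x,x_1,x_2\in\mathbb{R}^n$, $$\|f(t,x)\|\le \beta\,\mu'(t)\mu^{-1}(t),\qquad \|f(t,x_1)-f(t,x_2)\|\le \gamma\,\mu'(t)\mu^{-1}(t)\,\|x_1-x_2\|,$$ and $6K\gamma\alpha^{-1}<1$. Then the nonlinear system $x'=A(t)x+f(t,x)$ is topologically conjugated to the linear system $x'=A(t)x$; that is, there is a map $H:\mathbb{R}\times\mathbb{R}^n\to\mathbb{R}^n$ such that: (i) for each fixed $t$, $H(t,\cdot)$ is a homeomorphism of $\mathbb{R}^n$ onto $\mathbb{R}^n$; (ii) $\|H(t,x)-x\|\le 2K\beta\alpha^{-1}$ for all $t\in\mathbb{R}$, $x\in\mathbb{R}^n$; (iii) $G(t,\cdot):=H^{-1}(t,\cdot)$ satisfies $\|G(t,y)-y\|\le 2K\beta\alpha^{-1}$ for all $t\in\mathbb{R}$, $y\in\mathbb{R}^n$; (iv) if $x(t)$ is a solution of $x'=A(t)x+f(t,x)$ then $H(t,x(t))$ is a solution of $x'=A(t)x$, and if $y(t)$ is a solution of $x'=A(t)x$ then $G(t,y(t))$ is a solution of 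$x'=A(t)x+f(t,x)$.
   Context: $\|\cdot\|$ is a norm on $\mathbb{R}^n$ and also the induced operator norm. $T(t,s)$ denotes the evolution operator of $x'=A(t)x$, i.e. $T(t,s)x(s)=x(t)$ for every solution $x$. A growth rate is an increasing, differentiable function $\mu:\mathbb{R}\to(0,\infty)$ with $\mu(0)=1$, $\lim_{t\to-\infty}\mu(t)=0$ and $\lim_{t\to+\infty}\mu(t)=+\infty$. The system $x'=A(t)x$ admits an algebraic dichotomy (with respect to $\mu$) if there are projections $P(s)$, $s\in\mathbb{R}$, with $Q(s)=I-P(s)$, and constants $K>0,\alpha>0$ such that $T(t,s)P(s)=P(t)T(t,s)$ for all $t,s$, $\|T(t,s)P(s)\|\le K(\mu(t)/\mu(s))^{-\alpha}$ for $t\ge s$, and $\|T(t,s)Q(s)\|\le K(\mu(s)/\mu(t))^{-\alpha}$ for $t\le s$. *)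

theory Defs
  imports "HOL-Analysis.Analysis"
begin

text \<open>Operator norm of a matrix, induced by the (Euclidean) norm on vectors.\<close>
definition opnorm :: "real ^ 'n ^ 'n \<Rightarrow> real" where
  "opnorm M = onorm (\<lambda>x. M *v x)"

text \<open>Growth rate.\<close>
definition growth_rate :: "(real \<Rightarrow> real) \<Rightarrow> bool" where
  "growth_rate \<mu> \<longleftrightarrow> mono \<mu> \<and> (\<forall>t. \<mu> differentiable (at t)) \<and> (\<forall>t. \<mu> t > 0)
     \<and> \<mu> 0 = 1 \<and> (\<mu> \<longlongrightarrow> 0) at_bot \<and> filterlim \<mu> at_top at_top"

text \<open>Global solutions of x' = A(t) x and of x' = A(t) x + f(t,x).\<close>
definition lin_solution :: "(real \<Rightarrow> real ^ 'n ^ 'n) \<Rightarrow> (real \<Rightarrow> real ^ 'n) \<Rightarrow> bool" where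
  "lin_solution A x \<longleftrightarrow> (\<forall>t. (x has_vector_derivative (A t *v x t)) (at t))"

definition nonlin_solution :: "(real \<Rightarrow> real ^ 'n ^ 'n) \<Rightarrow> (real \<Rightarrow> real ^ 'n \<Rightarrow> real ^ 'n)
    \<Rightarrow> (real \<Rightarrow> real ^ 'n) \<Rightarrow> bool" where
  "nonlin_solution A f x \<longleftrightarrow> (\<forall>t. (x has_vector_derivative (A t *v x t + f t (x t))) (at t))"

text \<open>T is the evolution operator of x' = A(t) x: T(t,s) x(s) = x(t) for every solution x.\<close>
definition evolution_operator :: "(real \<Rightarrow> real ^ 'n ^ 'n) \<Rightarrow> (real \<Rightarrow> real \<Rightarrow> real ^ 'n ^ 'n) \<Rightarrow> bool" where
  "evolution_operator A T \<longleftrightarrow> (\<forall>x. lin_solution A x \<longrightarrow> (\<forall>t s. T t s *v x s = x t))"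

text \<open>Algebraic dichotomy with respect to the growth rate mu, with projections P and constants K, alpha.\<close>
definition algebraic_dichotomy ::
  "(real \<Rightarrow> real \<Rightarrow> real ^ 'n ^ 'n) \<Rightarrow> (real \<Rightarrow> real) \<Rightarrow> (real \<Rightarrow> real ^ 'n ^ 'n) \<Rightarrow> real \<Rightarrow> real \<Rightarrow> bool" where
  "algebraic_dichotomy T \<mu> P K \<alpha> \<longleftrightarrow> K > 0 \<and> \<alpha> > 0
     \<and> (\<forall>s. P s ** P s = P s)
     \<and> (\<forall>t s. T t s ** P s = P t ** T t s)
     \<and> (\<forall>t s. t \<ge> s \<longrightarrow> opnorm (T t s ** P s) \<le> K * (\<mu> t / \<mu> s) powr (- \<alpha>))
     \<and> (\<forall>t s. t \<le> s \<longrightarrow> opnorm (T t s ** (mat 1 - P s)) \<le> K * (\<mu> s / \<mu> t) powr (- \<alpha>))"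

end

theory Submission
  imports Defs
begin

(* The Green operator of the dichotomy,
     green F t = \<integral>_{-\<infinity>}^t T(t,s) P(s) F(s) ds - \<integral>_t^\<infinity> T(t,s) Q(s) F(s) ds,
   sends every continuous F with |F| \<le> c \<mu>'/\<mu> to a solution of x' = A(t) x + F(t) of size at
   most 2Kc/\<alpha>, because (\<mu>(t)/\<mu>(s))^(-\<alpha>) \<mu>'(s)/\<mu>(s) integrates to 1/\<alpha> over either half-line.
   Hence H(t, \<xi>) = \<xi> - green (f(., x)) t, where x is the perturbed solution through (t, \<xi>),
   moves perturbed solutions to linear ones. Conversely, along a linear solution y the map
   z \<mapsto> green (f(., y + z)) is a (2K\<gamma>/\<alpha>)-contraction on bounded continuous functions, and
   its fixed point z gives G(t, y(t)) = y(t) + z(t). Uniqueness of bounded fixed points makes G and H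
   mutually inverse; H(t, .) is continuous by continuous dependence on initial values and dominated
   convergence, so invariance of domain makes it a homeomorphism. Global solutions of both
   systems come from Picard iteration in a Bielecki-weighted sup norm. *)


section \<open>Integrals on the real line\<close>

definition oriented_integral :: "real \<Rightarrow> real \<Rightarrow> (real \<Rightarrow> 'a::banach) \<Rightarrow> 'a" where
  "oriented_integral s t g = (if s \<le> t then integral {s..t} g else - integral {t..s} g)"

lemma oriented_integral_self [simp]: "oriented_integral s s g = 0"
  by (simp add: oriented_integral_def)

lemma norm_oriented_integral: "norm (oriented_integral s t g) = norm (integral {min s t..max s t} g)"
  by (simp add: oriented_integral_def min_def max_def)

lemma integrable_on_continuous_UNIV:
  fixes g :: "real \<Rightarrow> 'a::banach"
  assumes "continuous_on UNIV g"
  shows "g integrable_on {a..b}"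
  using assms by (metis continuous_on_subset integrable_continuous_real top_greatest)

lemma oriented_integral_eq_diff:
  fixes g :: "real \<Rightarrow> 'a::banach"
  assumes g: "continuous_on UNIV g" and "a \<le> s" "a \<le> t"
  shows "oriented_integral s t g = integral {a..t} g - integral {a..s} g"
  using Henstock_Kurzweil_Integration.integral_combine[of a s t g, OF _ _ integrable_on_continuous_UNIV[OF g]]
    Henstock_Kurzweil_Integration.integral_combine[of a t s g, OF _ _ integrable_on_continuous_UNIV[OF g]]
    assms
  by (auto simp: oriented_integral_def algebra_simps)

lemma has_vector_derivative_oriented_integral:
  fixes g :: "real \<Rightarrow> 'a::banach"
  assumes g: "continuous_on UNIV g"
  shows "((\<lambda>t. oriented_integral s t g) has_vector_derivative g t) (at t)"
proof -
  define a where "a = min s t - 1"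
  have "((\<lambda>u. integral {a..u} g) has_vector_derivative g t) (at t within {a..t+1})"
    by (rule integral_has_vector_derivative[OF continuous_on_subset[OF g]]) (auto simp: a_def)
  then have "((\<lambda>u. integral {a..u} g) has_vector_derivative g t) (at t within {a<..<t+1})"
    by (rule has_vector_derivative_within_subset) auto
  then have "((\<lambda>u. integral {a..u} g) has_vector_derivative g t) (at t)"
    by (subst (asm) has_vector_derivative_within_open) (auto simp: a_def)
  then have "((\<lambda>u. integral {a..u} g - integral {a..s} g) has_vector_derivative g t) (at t)"
    using has_vector_derivative_diff[OF _ has_vector_derivative_const] by fastforce
  then show ?thesis
  proof (rule has_vector_derivative_transform_within_open[where S = "{a<..}"])
    show "integral {a..u} g - integral {a..s} g = oriented_integral s u g" if "u \<in> {a<..}" for u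
      using oriented_integral_eq_diff[OF g, of a s u] that by (simp add: a_def)
  qed (auto simp: a_def)
qed

lemma continuous_on_oriented_integral:
  fixes g :: "real \<Rightarrow> 'a::banach"
  assumes "continuous_on UNIV g"
  shows "continuous_on UNIV (\<lambda>t. oriented_integral s t g)"
  using has_vector_derivative_continuous[OF has_vector_derivative_oriented_integral[OF assms]]
  by (simp add: continuous_at_imp_continuous_on)

lemma oriented_integral_diff:
  fixes g h :: "real \<Rightarrow> 'a::banach"
  assumes "continuous_on UNIV g" "continuous_on UNIV h"
  shows "oriented_integral s t (\<lambda>u. g u - h u) = oriented_integral s t g - oriented_integral s t h"
  using integral_diff[OF integrable_on_continuous_UNIV[OF assms(1)] integrable_on_continuous_UNIV[OF assms(2)]]
  by (simp add: oriented_integral_def)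

lemma has_integral_of_real_derivative:
  fixes f f' :: "real \<Rightarrow> real"
  assumes "a \<le> b" and "\<And>x. a \<le> x \<Longrightarrow> x \<le> b \<Longrightarrow> (f has_real_derivative f' x) (at x)"
  shows "(f' has_integral f b - f a) {a..b}"
  using assms
  by (intro fundamental_theorem_of_calculus)
     (auto simp: has_real_derivative_iff_has_vector_derivative[symmetric] intro: has_field_derivative_at_within)

lemma integral_atMost_eq_oriented:
  fixes g :: "real \<Rightarrow> 'a::euclidean_space"
  assumes g: "continuous_on UNIV g" and g_int: "\<And>b. g integrable_on {..b}"
  shows "integral {..u} g = integral {..a} g + oriented_integral a u g"
proof (cases "a \<le> u")
  case True
  have "{..u} = {..a} \<union> {a..u}"
    using True by auto
  then have "integral {..u} g = integral ({..a} \<union> {a..u}) g"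
    by simp
  also have "\<dots> = integral {..a} g + integral {a..u} g"
    by (rule integral_Un[OF g_int integrable_on_continuous_UNIV[OF g]]) (rule negligible_subset[of "{a}"], auto)
  finally show ?thesis
    using True by (simp add: oriented_integral_def)
next
  case False
  have "{..a} = {..u} \<union> {u..a}"
    using False by auto
  then have "integral {..a} g = integral ({..u} \<union> {u..a}) g"
    by simp
  also have "\<dots> = integral {..u} g + integral {u..a} g"
    by (rule integral_Un[OF g_int integrable_on_continuous_UNIV[OF g]]) (rule negligible_subset[of "{u}"], auto)
  finally show ?thesis
    using False by (simp add: oriented_integral_def)
qed

lemma integral_atLeast_eq_oriented:
  fixes g :: "real \<Rightarrow> 'a::euclidean_space"
  assumes g: "continuous_on UNIV g" and g_int: "\<And>b. g integrable_on {b..}"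
  shows "integral {u..} g = integral {a..} g - oriented_integral a u g"
proof (cases "a \<le> u")
  case True
  have "{a..} = {a..u} \<union> {u..}"
    using True by auto
  then have "integral {a..} g = integral ({a..u} \<union> {u..}) g"
    by simp
  also have "\<dots> = integral {a..u} g + integral {u..} g"
    by (rule integral_Un[OF integrable_on_continuous_UNIV[OF g] g_int]) (rule negligible_subset[of "{u}"], auto)
  finally show ?thesis
    using True by (simp add: oriented_integral_def)
next
  case False
  have "{u..} = {u..a} \<union> {a..}"
    using False by auto
  then have "integral {u..} g = integral ({u..a} \<union> {a..}) g"
    by simp
  also have "\<dots> = integral {u..a} g + integral {a..} g"
    by (rule integral_Un[OF integrable_on_continuous_UNIV[OF g] g_int]) (rule negligible_subset[of "{a}"], auto)
  finally show ?thesis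
    using False by (simp add: oriented_integral_def)
qed

lemma has_vector_derivative_integral_atMost:
  fixes g :: "real \<Rightarrow> 'a::euclidean_space"
  assumes g: "continuous_on UNIV g" and "\<And>b. g integrable_on {..b}"
  shows "((\<lambda>u. integral {..u} g) has_vector_derivative g t) (at t)"
proof -
  have "((\<lambda>u. integral {..0} g + oriented_integral 0 u g) has_vector_derivative 0 + g t) (at t)"
    by (intro has_vector_derivative_add has_vector_derivative_const has_vector_derivative_oriented_integral g)
  moreover have "(\<lambda>u. integral {..u} g) = (\<lambda>u. integral {..0} g + oriented_integral 0 u g)"
    by (rule ext) (rule integral_atMost_eq_oriented[OF assms])
  ultimately show ?thesis
    by simp
qed

lemma has_vector_derivative_integral_atLeast:
  fixes g :: "real \<Rightarrow> 'a::euclidean_space"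
  assumes g: "continuous_on UNIV g" and "\<And>b. g integrable_on {b..}"
  shows "((\<lambda>u. integral {u..} g) has_vector_derivative - g t) (at t)"
proof -
  have "((\<lambda>u. integral {0..} g - oriented_integral 0 u g) has_vector_derivative 0 - g t) (at t)"
    by (intro has_vector_derivative_diff has_vector_derivative_const has_vector_derivative_oriented_integral g)
  moreover have "(\<lambda>u. integral {u..} g) = (\<lambda>u. integral {0..} g - oriented_integral 0 u g)"
    by (rule ext) (rule integral_atLeast_eq_oriented[OF assms])
  ultimately show ?thesis
    by simp
qed

lemma has_integral_atLeast_of_tendsto_at_top:
  fixes \<rho> \<rho>' :: "real \<Rightarrow> real"
  assumes deriv: "\<And>s. t \<le> s \<Longrightarrow> (\<rho> has_real_derivative \<rho>' s) (at s)"
    and nonneg: "\<And>s. t \<le> s \<Longrightarrow> 0 \<le> \<rho>' s"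
    and lim: "(\<rho> \<longlongrightarrow> 0) at_top"
  shows "(\<rho>' has_integral - \<rho> t) {t..}"
proof (rule has_integral_to_inf)
  have ftc: "(\<rho>' has_integral \<rho> y - \<rho> t) {t..y}" if "t \<le> y" for y
    using that deriv by (intro has_integral_of_real_derivative) auto
  show "\<rho>' integrable_on {t..y}" for y
    using ftc[of y] by (cases "t \<le> y") auto
  have "\<forall>\<^sub>F y in at_top. \<rho> y - \<rho> t = integral {t..y} \<rho>'"
    by (rule eventually_mono[OF eventually_ge_at_top[of t]]) (use ftc integral_unique in metis)
  moreover have "((\<lambda>y. \<rho> y - \<rho> t) \<longlongrightarrow> 0 - \<rho> t) at_top"
    by (intro tendsto_intros lim)
  ultimately show "((\<lambda>y. integral {t..y} \<rho>') \<longlongrightarrow> - \<rho> t) at_top"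
    using Lim_transform_eventually by fastforce
qed (rule nonneg)

lemma has_integral_atMost_of_tendsto_at_bot:
  fixes \<rho> \<rho>' :: "real \<Rightarrow> real"
  assumes deriv: "\<And>s. s \<le> t \<Longrightarrow> (\<rho> has_real_derivative \<rho>' s) (at s)"
    and nonneg: "\<And>s. s \<le> t \<Longrightarrow> 0 \<le> \<rho>' s"
    and lim: "(\<rho> \<longlongrightarrow> 0) at_bot"
  shows "(\<rho>' has_integral \<rho> t) {..t}"
proof -
  have "((\<lambda>s. \<rho>' (- s)) has_integral - (- \<rho> (- (- t)))) {- t..}"
  proof (rule has_integral_atLeast_of_tendsto_at_top)
    show "((\<lambda>s. - \<rho> (- s)) has_real_derivative \<rho>' (- s)) (at s)" if "- t \<le> s" for s
      using DERIV_minus[OF DERIV_mirror[THEN iffD1, OF deriv[of "- s"]]] that by simp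
    show "((\<lambda>s. - \<rho> (- s)) \<longlongrightarrow> 0) at_top"
      using tendsto_minus[OF filterlim_compose[OF lim filterlim_uminus_at_bot_at_top]] by simp
  qed (use nonneg in simp)
  then have "(\<lambda>s. \<rho>' (- s)) absolutely_integrable_on {- t..} \<and> integral {- t..} (\<lambda>s. \<rho>' (- s)) = \<rho> t"
    using nonneg by (auto intro!: nonnegative_absolutely_integrable_1 simp: has_integral_iff)
  then have "\<rho>' absolutely_integrable_on {..t} \<and> integral {..t} \<rho>' = \<rho> t"
    by (subst (asm) has_absolute_integral_reflect_real) auto
  then show ?thesis
    using set_lebesgue_integral_eq_integral(1) has_integral_integrable_integral by blast
qed

lemma integrable_on_and_norm_integral_le:
  fixes g :: "real \<Rightarrow> 'a::euclidean_space"
  assumes g: "continuous_on S g" and S: "S \<in> sets lebesgue"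
    and h: "(h has_integral I) S" and bound: "\<And>x. x \<in> S \<Longrightarrow> norm (g x) \<le> h x"
  shows "g integrable_on S" "norm (integral S g) \<le> I"
proof -
  have meas: "g \<in> borel_measurable (lebesgue_on S)"
    by (rule continuous_imp_measurable_on_sets_lebesgue[OF g S])
  show "g integrable_on S"
    by (rule measurable_bounded_by_integrable_imp_integrable[OF meas has_integral_integrable[OF h] bound S])
  show "norm (integral S g) \<le> I"
    by (rule integral_norm_bound_integral'[OF _ meas _ h]) (auto simp: bound S)
qed

section \<open>Global solutions of Lipschitz equations\<close>

lemma continuous_on_UNIV_compose_Pair:
  fixes F :: "real \<Rightarrow> 'a::topological_space \<Rightarrow> 'b::topological_space"
  assumes F: "continuous_on UNIV (\<lambda>(t, x). F t x)" and x: "continuous_on UNIV x"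
  shows "continuous_on UNIV (\<lambda>t. F t (x t))"
  using continuous_on_compose[OF continuous_on_Pair[OF continuous_on_id x] continuous_on_subset[OF F]]
  by (simp add: o_def)

lemma has_vector_derivative_imp_continuous_on:
  assumes "\<And>t. (x has_vector_derivative x' t) (at t)"
  shows "continuous_on UNIV x"
  using has_vector_derivative_continuous[OF assms] by (simp add: continuous_at_imp_continuous_on)

lemma solution_eq_oriented_integral:
  fixes F :: "real \<Rightarrow> 'a::banach \<Rightarrow> 'a"
  assumes F: "continuous_on UNIV (\<lambda>(t, x). F t x)"
    and x: "\<And>t. (x has_vector_derivative F t (x t)) (at t)"
  shows "x t = x s + oriented_integral s t (\<lambda>u. F u (x u))"
proof -
  have Fx: "continuous_on UNIV (\<lambda>u. F u (x u))"
    by (rule continuous_on_UNIV_compose_Pair[OF F has_vector_derivative_imp_continuous_on[OF x]])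
  have "((\<lambda>u. x u - oriented_integral s u (\<lambda>u. F u (x u))) has_derivative (\<lambda>_. 0)) (at u within UNIV)" for u
    using has_vector_derivative_diff[OF x has_vector_derivative_oriented_integral[OF Fx]]
    by (simp add: has_vector_derivative_def)
  from has_derivative_zero_unique[OF convex_UNIV this]
  have "x t - oriented_integral s t (\<lambda>u. F u (x u)) = x s - oriented_integral s s (\<lambda>u. F u (x u))"
    by blast
  then show ?thesis by (simp add: diff_eq_eq)
qed

locale lipschitz_ode =
  fixes F :: "real \<Rightarrow> 'a::euclidean_space \<Rightarrow> 'a"
    and l \<Lambda> :: "real \<Rightarrow> real"
  assumes continuous_F: "continuous_on UNIV (\<lambda>(t, x). F t x)"
    and lipschitz_F: "\<And>t x y. norm (F t x - F t y) \<le> l t * norm (x - y)"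
    and norm_F_zero: "\<And>t. norm (F t 0) \<le> l t"
    and l_nonneg: "\<And>t. 0 \<le> l t"
    and \<Lambda>_deriv: "\<And>t. (\<Lambda> has_real_derivative l t) (at t)"
begin

definition solution :: "(real \<Rightarrow> 'a) \<Rightarrow> bool" where
  "solution x \<longleftrightarrow> (\<forall>t. (x has_vector_derivative F t (x t)) (at t))"

lemma continuous_on_solution: "solution x \<Longrightarrow> continuous_on UNIV x"
  unfolding solution_def by (rule has_vector_derivative_imp_continuous_on) blast

lemma continuous_on_F_solution: "solution x \<Longrightarrow> continuous_on UNIV (\<lambda>t. F t (x t))"
  by (rule continuous_on_UNIV_compose_Pair[OF continuous_F continuous_on_solution])

lemma \<Lambda>_mono: "s \<le> t \<Longrightarrow> \<Lambda> s \<le> \<Lambda> t"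
  by (rule DERIV_nonneg_imp_nondecreasing[of s t \<Lambda>]) (use \<Lambda>_deriv l_nonneg in auto)

lemma continuous_on_\<Lambda>: "continuous_on UNIV \<Lambda>"
  by (meson DERIV_continuous_on \<Lambda>_deriv)

text \<open>Bielecki's weight: in the sup norm weighted by it, the Picard operator contracts by \<open>1/2\<close>
  on the whole line, because \<open>\<integral>\<^sub>s\<^sup>t l u * weight s u du = (weight s t - 1) / 2\<close>.\<close>

definition weight :: "real \<Rightarrow> real \<Rightarrow> real" where
  "weight s t = exp (2 * \<bar>\<Lambda> t - \<Lambda> s\<bar>)"

lemma weight_ge_one: "1 \<le> weight s t"
  by (simp add: weight_def)

lemma weight_pos: "0 < weight s t"
  by (simp add: weight_def)

lemma continuous_on_weight: "continuous_on UNIV (weight s)"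
  and continuous_on_weight_left: "continuous_on UNIV (\<lambda>s. weight s t)"
  unfolding weight_def by (intro continuous_intros continuous_on_\<Lambda>)+

lemma has_integral_weight:
  "((\<lambda>u. l u * weight s u) has_integral (weight s t - 1) / 2) {min s t..max s t}"
proof (cases "s \<le> t")
  case True
  have "((\<lambda>u. exp (2 * (\<Lambda> u - \<Lambda> s)) / 2) has_real_derivative l u * exp (2 * (\<Lambda> u - \<Lambda> s))) (at u)" for u
    by (auto intro!: derivative_eq_intros \<Lambda>_deriv)
  from has_integral_of_real_derivative[OF True this]
  have "((\<lambda>u. l u * exp (2 * (\<Lambda> u - \<Lambda> s))) has_integral (weight s t - 1) / 2) {s..t}"
    using \<Lambda>_mono[OF True] by (simp add: weight_def diff_divide_distrib)
  moreover have "l u * exp (2 * (\<Lambda> u - \<Lambda> s)) = l u * weight s u" if "u \<in> {s..t}" for u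
    using \<Lambda>_mono[of s u] that by (simp add: weight_def)
  ultimately have "((\<lambda>u. l u * weight s u) has_integral (weight s t - 1) / 2) {s..t}"
    by (rule has_integral_eq[rotated])
  then show ?thesis
    using True by simp
next
  case False
  then have "t \<le> s" by simp
  have "((\<lambda>u. - exp (2 * (\<Lambda> s - \<Lambda> u)) / 2) has_real_derivative l u * exp (2 * (\<Lambda> s - \<Lambda> u))) (at u)" for u
    by (auto intro!: derivative_eq_intros \<Lambda>_deriv)
  from has_integral_of_real_derivative[OF \<open>t \<le> s\<close> this]
  have "((\<lambda>u. l u * exp (2 * (\<Lambda> s - \<Lambda> u))) has_integral (weight s t - 1) / 2) {t..s}"
    using \<Lambda>_mono[OF \<open>t \<le> s\<close>] by (simp add: weight_def diff_divide_distrib)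
  moreover have "l u * exp (2 * (\<Lambda> s - \<Lambda> u)) = l u * weight s u" if "u \<in> {t..s}" for u
    using \<Lambda>_mono[of u s] that by (simp add: weight_def abs_minus_commute)
  ultimately have "((\<lambda>u. l u * weight s u) has_integral (weight s t - 1) / 2) {t..s}"
    by (rule has_integral_eq[rotated])
  then show ?thesis
    using False by simp
qed

lemma norm_add_oriented_integral_le:
  fixes g :: "real \<Rightarrow> 'a"
  assumes g: "continuous_on UNIV g" and c: "0 \<le> c"
    and bound: "\<And>u. u \<in> {min s t..max s t} \<Longrightarrow> norm (g u) \<le> c * l u * weight s u"
  shows "norm (\<xi> + oriented_integral s t g) \<le> (norm \<xi> + c / 2) * weight s t"
proof -
  have "norm (integral {min s t..max s t} g) \<le> c * ((weight s t - 1) / 2)"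
  proof (rule integral_norm_bound_integral')
    show "((\<lambda>u. c * (l u * weight s u)) has_integral c * ((weight s t - 1) / 2)) {min s t..max s t}"
      by (rule has_integral_mult_right[OF has_integral_weight])
    show "g \<in> borel_measurable (lebesgue_on {min s t..max s t})"
      by (rule continuous_imp_measurable_on_sets_lebesgue[OF continuous_on_subset[OF g]]) auto
  qed (use bound in \<open>auto simp: mult.assoc\<close>)
  then have "norm (\<xi> + oriented_integral s t g) \<le> norm \<xi> + c * (weight s t - 1) / 2"
    using norm_triangle_ineq[of \<xi> "oriented_integral s t g"] by (simp add: norm_oriented_integral)
  also have "\<dots> \<le> (norm \<xi> + c / 2) * weight s t"
  proof -
    have "(norm \<xi> + c / 2) * weight s t - (norm \<xi> + c * (weight s t - 1) / 2)
        = norm \<xi> * (weight s t - 1) + c / 2"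
      by (simp add: field_simps)
    moreover have "0 \<le> norm \<xi> * (weight s t - 1)"
      using weight_ge_one[of s t] by simp
    ultimately show ?thesis
      using c by linarith
  qed
  finally show ?thesis .
qed

lemma norm_solution_diff_le:
  assumes x: "solution x" and y: "solution y" and D: "0 \<le> D"
    and bound: "\<And>u. u \<in> {min s r..max s r} \<Longrightarrow> norm (x u - y u) \<le> D * weight s u"
  shows "norm (x r - y r) \<le> (norm (x s - y s) + D / 2) * weight s r"
proof -
  have "x r - y r = (x s - y s) + oriented_integral s r (\<lambda>u. F u (x u) - F u (y u))"
    unfolding oriented_integral_diff[OF continuous_on_F_solution[OF x] continuous_on_F_solution[OF y]]
    using solution_eq_oriented_integral[OF continuous_F, of x r s] solution_eq_oriented_integral[OF continuous_F, of y r s]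
      x y by (simp add: solution_def algebra_simps)
  also have "norm \<dots> \<le> (norm (x s - y s) + D / 2) * weight s r"
  proof (rule norm_add_oriented_integral_le)
    fix u assume "u \<in> {min s r..max s r}"
    from mult_left_mono[OF bound[OF this] l_nonneg[of u]]
    have "l u * norm (x u - y u) \<le> D * l u * weight s u"
      by (simp add: ac_simps)
    then show "norm (F u (x u) - F u (y u)) \<le> D * l u * weight s u"
      using lipschitz_F[of u "x u" "y u"] by linarith
  next
    show "continuous_on UNIV (\<lambda>u. F u (x u) - F u (y u))"
      using continuous_on_F_solution[OF x] continuous_on_F_solution[OF y] by (rule continuous_on_diff)
  qed (rule D)
  finally show ?thesis .
qed

lemma solution_dist_le:
  assumes x: "solution x" and y: "solution y"
  shows "norm (x t - y t) \<le> 2 * weight s t * norm (x s - y s)"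
proof -
  define I where "I = {min s t..max s t}"
  define \<phi> where "\<phi> u = norm (x u - y u) / weight s u" for u
  have "continuous_on I \<phi>"
    unfolding \<phi>_def using weight_pos[of s, THEN less_imp_neq]
    by (intro continuous_intros continuous_on_subset[OF continuous_on_solution[OF x]]
        continuous_on_subset[OF continuous_on_solution[OF y]] continuous_on_subset[OF continuous_on_weight])
      auto
  then obtain r where r: "r \<in> I" and max: "\<And>u. u \<in> I \<Longrightarrow> \<phi> u \<le> \<phi> r"
    using continuous_attains_sup[of I \<phi>] unfolding I_def by fastforce
  have "norm (x r - y r) \<le> (norm (x s - y s) + \<phi> r / 2) * weight s r"
  proof (rule norm_solution_diff_le[OF x y])
    show "0 \<le> \<phi> r"
      using weight_pos[of s r] by (simp add: \<phi>_def)
    fix u assume "u \<in> {min s r..max s r}"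
    with r have "u \<in> I"
      unfolding I_def by auto
    then have "\<phi> u \<le> \<phi> r"
      by (rule max)
    then show "norm (x u - y u) \<le> \<phi> r * weight s u"
      using weight_pos[of s u] by (simp add: \<phi>_def divide_le_eq)
  qed
  then have "\<phi> r \<le> norm (x s - y s) + \<phi> r / 2"
    using weight_pos[of s r] by (simp add: \<phi>_def divide_le_eq)
  moreover have "\<phi> t \<le> \<phi> r"
    using max unfolding I_def by auto
  ultimately have "\<phi> t \<le> 2 * norm (x s - y s)"
    by linarith
  then show ?thesis
    using weight_pos[of s t] by (simp add: \<phi>_def divide_le_eq ac_simps)
qed

lemma solution_unique:
  assumes "solution x" "solution y" "x s = y s"
  shows "x = y"
proof
  show "x t = y t" for t
    using solution_dist_le[OF assms(1,2), of t s] assms(3) by simp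
qed

text \<open>The Picard operator conjugated by the weight: a fixed point \<open>u\<close> yields the solution
  \<open>\<lambda>t. weight s t *\<^sub>R u t\<close> through \<open>(s, \<xi>)\<close>.\<close>

definition weighted_picard :: "real \<Rightarrow> 'a \<Rightarrow> (real \<Rightarrow>\<^sub>C 'a) \<Rightarrow> real \<Rightarrow> 'a" where
  "weighted_picard s \<xi> u t =
     inverse (weight s t) *\<^sub>R (\<xi> + oriented_integral s t (\<lambda>r. F r (weight s r *\<^sub>R apply_bcontfun u r)))"

lemma continuous_on_F_weighted:
  "continuous_on UNIV (\<lambda>r. F r (weight s r *\<^sub>R apply_bcontfun u r))"
  by (intro continuous_on_UNIV_compose_Pair[OF continuous_F] continuous_intros continuous_on_weight
      continuous_on_apply_bcontfun)

lemma norm_F_weighted_le: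
  "norm (F r (weight s r *\<^sub>R apply_bcontfun u r)) \<le> (1 + norm u) * l r * weight s r"
proof -
  have "norm (F r (weight s r *\<^sub>R apply_bcontfun u r))
      \<le> l r * norm (weight s r *\<^sub>R apply_bcontfun u r) + l r"
    using lipschitz_F[of r "weight s r *\<^sub>R apply_bcontfun u r" 0] norm_F_zero[of r]
      norm_triangle_sub[of "F r (weight s r *\<^sub>R apply_bcontfun u r)" "F r 0"] by simp
  also have "\<dots> \<le> l r * (weight s r * norm u) + l r * weight s r"
    using norm_bounded[of u r] weight_pos[of s r] mult_left_mono[OF weight_ge_one[of s r] l_nonneg[of r]]
      l_nonneg[of r]
    by (intro add_mono mult_left_mono) auto
  finally show ?thesis
    by (simp add: algebra_simps)
qed

lemma weighted_picard_in_bcontfun: "weighted_picard s \<xi> u \<in> bcontfun"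
proof (rule bcontfun_normI)
  show "continuous_on UNIV (weighted_picard s \<xi> u)"
    unfolding weighted_picard_def using weight_pos[of s, THEN less_imp_neq]
    by (intro continuous_intros continuous_on_weight continuous_on_oriented_integral continuous_on_F_weighted)
      auto
  have "norm (weighted_picard s \<xi> u t) \<le> norm \<xi> + (1 + norm u) / 2" for t
  proof -
    have "norm (\<xi> + oriented_integral s t (\<lambda>r. F r (weight s r *\<^sub>R apply_bcontfun u r)))
        \<le> (norm \<xi> + (1 + norm u) / 2) * weight s t"
      by (intro norm_add_oriented_integral_le continuous_on_F_weighted norm_F_weighted_le) simp
    then show ?thesis
      using weight_pos[of s t] by (simp add: weighted_picard_def divide_simps mult.commute)
  qed
  then show "norm (weighted_picard s \<xi> u t) \<le> norm \<xi> + (1 + norm u) / 2" for t .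
qed

lemma dist_weighted_picard_le:
  "dist (weighted_picard s \<xi> u t) (weighted_picard s \<xi> v t) \<le> dist u v / 2"
proof -
  let ?Fu = "\<lambda>r. F r (weight s r *\<^sub>R apply_bcontfun u r)"
  let ?Fv = "\<lambda>r. F r (weight s r *\<^sub>R apply_bcontfun v r)"
  have "norm (0 + oriented_integral s t (\<lambda>r. ?Fu r - ?Fv r)) \<le> (norm (0::'a) + dist u v / 2) * weight s t"
  proof (rule norm_add_oriented_integral_le)
    fix r
    have "norm (?Fu r - ?Fv r) \<le> l r * norm (weight s r *\<^sub>R (apply_bcontfun u r - apply_bcontfun v r))"
      using lipschitz_F[of r] by (simp add: scaleR_diff_right)
    also have "\<dots> \<le> l r * (weight s r * dist u v)"
      using dist_bounded[of u r v] weight_pos[of s r] l_nonneg[of r]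
      by (intro mult_left_mono) (auto simp: dist_norm)
    finally show "norm (?Fu r - ?Fv r) \<le> dist u v * l r * weight s r"
      by (simp add: ac_simps)
  qed (auto intro: continuous_on_diff continuous_on_F_weighted)
  moreover have "weighted_picard s \<xi> u t - weighted_picard s \<xi> v t
      = inverse (weight s t) *\<^sub>R oriented_integral s t (\<lambda>r. ?Fu r - ?Fv r)"
    unfolding weighted_picard_def oriented_integral_diff[OF continuous_on_F_weighted continuous_on_F_weighted]
    by (simp add: algebra_simps)
  ultimately show ?thesis
    using weight_pos[of s t] by (simp add: dist_norm field_simps)
qed

lemma solution_exists: "\<exists>x. solution x \<and> x s = \<xi>"
proof -
  define \<Psi> where "\<Psi> u = Bcontfun (weighted_picard s \<xi> u)" for u
  have apply_\<Psi>: "apply_bcontfun (\<Psi> u) = weighted_picard s \<xi> u" for u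
    unfolding \<Psi>_def using weighted_picard_in_bcontfun by (simp add: Bcontfun_inverse)
  have "dist (\<Psi> u) (\<Psi> v) \<le> 1 / 2 * dist u v" for u v
    by (rule dist_bound) (use dist_weighted_picard_le[of s \<xi> u _ v] in \<open>simp add: apply_\<Psi>\<close>)
  then obtain u where u: "\<Psi> u = u"
    using banach_fix_type[of "1/2" \<Psi>] by auto
  define x where "x t = weight s t *\<^sub>R apply_bcontfun u t" for t
  have x_eq: "x t = \<xi> + oriented_integral s t (\<lambda>r. F r (x r))" for t
    using arg_cong[OF u[symmetric], of "\<lambda>u. apply_bcontfun u t"] weight_pos[of s t]
    by (simp add: apply_\<Psi> weighted_picard_def x_def)
  have "(x has_vector_derivative F t (x t)) (at t)" for t
    using has_vector_derivative_add[OF has_vector_derivative_const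
        has_vector_derivative_oriented_integral[OF continuous_on_F_weighted[of s u, folded x_def]]]
    by (subst x_eq[abs_def]) simp
  then have "solution x"
    by (simp add: solution_def)
  moreover have "x s = \<xi>"
    using x_eq[of s] by simp
  ultimately show ?thesis by blast
qed

definition flow :: "real \<Rightarrow> 'a \<Rightarrow> real \<Rightarrow> 'a" where
  "flow s \<xi> = (THE x. solution x \<and> x s = \<xi>)"

lemma flow: "solution (flow s \<xi>)" "flow s \<xi> s = \<xi>"
proof -
  have "\<exists>!x. solution x \<and> x s = \<xi>"
    using solution_exists solution_unique by blast
  then show "solution (flow s \<xi>)" "flow s \<xi> s = \<xi>"
    unfolding flow_def by (metis (mono_tags, lifting) theI')+
qed

lemma flow_eq: "solution x \<Longrightarrow> flow t (x t) = x"
  by (rule solution_unique[where s = t, OF flow(1)]) (simp_all add: flow(2))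

lemma flow_tendsto:
  assumes "\<xi>s \<longlonglongrightarrow> \<xi>"
  shows "(\<lambda>k. flow s (\<xi>s k) t) \<longlonglongrightarrow> flow s \<xi> t"
proof -
  have "norm (flow s (\<xi>s k) t - flow s \<xi> t) \<le> 2 * weight s t * norm (flow s (\<xi>s k) s - flow s \<xi> s)" for k
    by (rule solution_dist_le[OF flow(1) flow(1)])
  then have bound: "norm (flow s (\<xi>s k) t - flow s \<xi> t) \<le> 2 * weight s t * norm (\<xi>s k - \<xi>)" for k
    by (simp add: flow(2))
  have "(\<lambda>k. 2 * weight s t * norm (\<xi>s k - \<xi>)) \<longlonglongrightarrow> 0"
    using assms by (intro tendsto_mult_right_zero) (simp add: LIM_zero tendsto_norm_zero)
  then have "(\<lambda>k. flow s (\<xi>s k) t - flow s \<xi> t) \<longlonglongrightarrow> 0"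
    by (rule Lim_null_comparison[OF always_eventually, rotated]) (use bound in blast)
  then show ?thesis
    by (rule LIM_zero_cancel)
qed

end

section \<open>Growth rates\<close>

lemma growth_rate_pos: "growth_rate \<mu> \<Longrightarrow> 0 < \<mu> t"
  by (simp add: growth_rate_def)

lemma growth_rate_has_derivative: "growth_rate \<mu> \<Longrightarrow> (\<mu> has_real_derivative deriv \<mu> t) (at t)"
  by (simp add: growth_rate_def DERIV_deriv_iff_real_differentiable)

lemma growth_rate_deriv_nonneg: "growth_rate \<mu> \<Longrightarrow> 0 \<le> deriv \<mu> t"
  by (rule mono_on_imp_deriv_nonneg[where A = UNIV and x = t]) (auto simp: growth_rate_def growth_rate_has_derivative)

lemma growth_rate_tendsto_at_bot: "growth_rate \<mu> \<Longrightarrow> (\<mu> \<longlongrightarrow> 0) at_bot"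
  and growth_rate_filterlim_at_top: "growth_rate \<mu> \<Longrightarrow> filterlim \<mu> at_top at_top"
  by (simp_all add: growth_rate_def)

lemma growth_rate_logderiv_nonneg: "growth_rate \<mu> \<Longrightarrow> 0 \<le> deriv \<mu> t / \<mu> t"
  by (simp add: growth_rate_deriv_nonneg growth_rate_pos less_imp_le)

lemma growth_rate_has_integral_atMost:
  assumes \<mu>: "growth_rate \<mu>" and \<alpha>: "0 < \<alpha>"
  shows "((\<lambda>s. (\<mu> t / \<mu> s) powr (- \<alpha>) * (deriv \<mu> s / \<mu> s)) has_integral 1 / \<alpha>) {..t}"
proof -
  define \<rho> where "\<rho> s = (\<mu> s / \<mu> t) powr \<alpha> / \<alpha>" for s
  have "((\<lambda>s. (\<mu> t / \<mu> s) powr (- \<alpha>) * (deriv \<mu> s / \<mu> s)) has_integral \<rho> t) {..t}"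
  proof (rule has_integral_atMost_of_tendsto_at_bot)
    show "(\<rho> has_real_derivative (\<mu> t / \<mu> s) powr (- \<alpha>) * (deriv \<mu> s / \<mu> s)) (at s)" for s
      unfolding \<rho>_def using growth_rate_pos[OF \<mu>, of s] growth_rate_pos[OF \<mu>, of t] \<alpha>
      by (auto intro!: derivative_eq_intros growth_rate_has_derivative[OF \<mu>]
          simp: powr_minus_divide powr_divide field_simps powr_diff)
    show "0 \<le> (\<mu> t / \<mu> s) powr (- \<alpha>) * (deriv \<mu> s / \<mu> s)" for s
      by (intro mult_nonneg_nonneg) (simp_all add: growth_rate_logderiv_nonneg[OF \<mu>])
    show "(\<rho> \<longlongrightarrow> 0) at_bot"
      unfolding \<rho>_def using \<alpha> growth_rate_pos[OF \<mu>]
      by (intro tendsto_divide_zero tendsto_zero_powrI[OF _ tendsto_const] growth_rate_tendsto_at_bot[OF \<mu>])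
        (auto intro!: always_eventually less_imp_le)
  qed
  then show ?thesis
    using \<alpha> growth_rate_pos[OF \<mu>, of t] by (simp add: \<rho>_def)
qed

lemma growth_rate_has_integral_atLeast:
  assumes \<mu>: "growth_rate \<mu>" and \<alpha>: "0 < \<alpha>"
  shows "((\<lambda>s. (\<mu> s / \<mu> t) powr (- \<alpha>) * (deriv \<mu> s / \<mu> s)) has_integral 1 / \<alpha>) {t..}"
proof -
  define \<rho> where "\<rho> s = - (\<mu> t powr \<alpha> * \<mu> s powr (- \<alpha>)) / \<alpha>" for s
  have "((\<lambda>s. (\<mu> s / \<mu> t) powr (- \<alpha>) * (deriv \<mu> s / \<mu> s)) has_integral - \<rho> t) {t..}"
  proof (rule has_integral_atLeast_of_tendsto_at_top)
    show "(\<rho> has_real_derivative (\<mu> s / \<mu> t) powr (- \<alpha>) * (deriv \<mu> s / \<mu> s)) (at s)" for s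
      unfolding \<rho>_def using growth_rate_pos[OF \<mu>, of s] growth_rate_pos[OF \<mu>, of t] \<alpha>
      by (auto intro!: derivative_eq_intros growth_rate_has_derivative[OF \<mu>]
          simp: powr_minus_divide powr_divide field_simps powr_diff)
    show "0 \<le> (\<mu> s / \<mu> t) powr (- \<alpha>) * (deriv \<mu> s / \<mu> s)" for s
      by (intro mult_nonneg_nonneg) (simp_all add: growth_rate_logderiv_nonneg[OF \<mu>])
    have "((\<lambda>s. \<mu> s powr (- \<alpha>)) \<longlongrightarrow> 0) at_top"
      using \<alpha> by (intro tendsto_neg_powr growth_rate_filterlim_at_top[OF \<mu>]) simp
    then show "(\<rho> \<longlongrightarrow> 0) at_top"
      unfolding \<rho>_def using tendsto_mult_right_zero tendsto_divide_zero tendsto_minus by fastforce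
  qed
  then show ?thesis
    using \<alpha> growth_rate_pos[OF \<mu>, of t] by (simp add: \<rho>_def powr_add[symmetric])
qed

section \<open>Matrices\<close>

lemma norm_matrix_vector_mult_le:
  fixes A :: "real ^ 'n ^ 'm"
  shows "norm (A *v x) \<le> norm A * norm x"
proof -
  have "norm (A *v x) = L2_set (\<lambda>i. \<bar>A $ i \<bullet> x\<bar>) UNIV"
    by (simp add: norm_vec_def matrix_mult_dot)
  also have "\<dots> \<le> L2_set (\<lambda>i. norm (A $ i) * norm x) UNIV"
    by (intro L2_set_mono) (auto simp: Cauchy_Schwarz_ineq2)
  also have "\<dots> = norm A * norm x"
    by (simp add: L2_set_left_distrib norm_vec_def[of A])
  finally show ?thesis .
qed

lemma norm_matrix_vector_mult_le_opnorm: "norm (B *v x) \<le> opnorm B * norm x"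
  unfolding opnorm_def by (rule onorm[OF matrix_vector_mul_bounded_linear])

lemma matrix_vector_mult_eq_sum_axis:
  fixes B :: "real ^ 'n ^ 'm"
  shows "B *v v = (\<Sum>i\<in>UNIV. v $ i *\<^sub>R (B *v axis i 1))"
  unfolding matrix_vector_mult_basis by (simp add: matrix_mult_sum scalar_mult_eq_scaleR)

lemma has_vector_derivative_matrix_vector_mult:
  fixes \<Phi> :: "real \<Rightarrow> real ^ 'n ^ 'm"
  assumes \<Phi>: "\<And>\<xi>. ((\<lambda>t. \<Phi> t *v \<xi>) has_vector_derivative \<Phi>' *v \<xi>) (at t)"
    and w: "(w has_vector_derivative w') (at t)"
  shows "((\<lambda>t. \<Phi> t *v w t) has_vector_derivative \<Phi>' *v w t + \<Phi> t *v w') (at t)"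
proof -
  have "((\<lambda>t. w t $ i) has_real_derivative w' $ i) (at t)" for i
    using bounded_linear.has_vector_derivative[OF bounded_linear_vec_nth w, of i]
    by (simp add: has_real_derivative_iff_has_vector_derivative)
  then have "((\<lambda>t. \<Sum>i\<in>UNIV. w t $ i *\<^sub>R (\<Phi> t *v axis i 1)) has_vector_derivative
      (\<Sum>i\<in>UNIV. w t $ i *\<^sub>R (\<Phi>' *v axis i 1) + w' $ i *\<^sub>R (\<Phi> t *v axis i 1))) (at t)"
    by (intro has_vector_derivative_sum has_vector_derivative_scaleR \<Phi>)
  then show ?thesis
    by (simp add: matrix_vector_mult_eq_sum_axis[of _ "w _"] matrix_vector_mult_eq_sum_axis[of _ w'] sum.distrib)
qed

lemma continuous_on_matrix_vector_mult_Pair: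
  fixes A :: "real \<Rightarrow> real ^ 'n ^ 'm"
  assumes "continuous_on UNIV A"
  shows "continuous_on UNIV (\<lambda>(t, x). A t *v x)"
proof -
  have "continuous_on UNIV (\<lambda>p::real \<times> (real ^ 'n). A (fst p) $ i $ j)" for i j
    by (intro continuous_on_component continuous_on_compose2[OF assms continuous_on_fst[OF continuous_on_id]]) auto
  moreover have "continuous_on UNIV (\<lambda>p::real \<times> (real ^ 'n). snd p $ j)" for j
    by (intro continuous_on_component continuous_on_snd continuous_on_id)
  ultimately show ?thesis
    unfolding matrix_vector_mult_def case_prod_unfold
    by (intro continuous_on_vec_lambda continuous_on_sum continuous_on_mult)
qed

section \<open>The linear system and its Green operator\<close>

locale dichotomic_system =
  fixes A :: "real \<Rightarrow> real ^ 'n ^ 'n"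
    and T :: "real \<Rightarrow> real \<Rightarrow> real ^ 'n ^ 'n"
    and P :: "real \<Rightarrow> real ^ 'n ^ 'n"
    and \<mu> :: "real \<Rightarrow> real"
    and K \<alpha> :: real
  assumes A_cont: "continuous_on UNIV A"
    and A_bdd: "bounded (range A)"
    and mu: "growth_rate \<mu>"
    and T: "evolution_operator A T"
    and dich: "algebraic_dichotomy T \<mu> P K \<alpha>"
begin

definition M :: real where
  "M = (SUP t. norm (A t))"

lemma norm_A_le: "norm (A t) \<le> M"
  unfolding M_def using A_bdd by (intro cSUP_upper bounded_imp_bdd_above) (simp_all add: bounded_norm_comp)

lemma M_nonneg: "0 \<le> M"
  using norm_A_le[of 0] norm_ge_zero order_trans by blast

lemma norm_A_mult_le: "norm (A t *v x) \<le> M * norm x"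
  using norm_matrix_vector_mult_le[of "A t" x] mult_right_mono[OF norm_A_le[of t] norm_ge_zero[of x]]
  by linarith

sublocale lin: lipschitz_ode "\<lambda>t x. A t *v x" "\<lambda>_. M" "\<lambda>t. M * t"
proof
  show "continuous_on UNIV (\<lambda>(t, x). A t *v x)"
    by (rule continuous_on_matrix_vector_mult_Pair[OF A_cont])
  show "norm (A t *v x - A t *v y) \<le> M * norm (x - y)" for t x y
    using norm_A_mult_le[of t "x - y"] by (simp add: matrix_vector_mult_diff_distrib)
  show "norm (A t *v 0) \<le> M" "0 \<le> M" for t
    using M_nonneg by simp_all
  show "((\<lambda>t. M * t) has_real_derivative M) (at t)" for t
    by (auto intro!: derivative_eq_intros)
qed

lemma lin_solution_iff: "lin.solution x \<longleftrightarrow> lin_solution A x"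
  by (simp add: lin.solution_def lin_solution_def)

lemma T_apply: "lin.solution x \<Longrightarrow> T t s *v x s = x t"
  using T by (simp add: evolution_operator_def lin_solution_iff)

lemma T_eq_flow: "T t s *v \<xi> = lin.flow s \<xi> t"
  using T_apply[OF lin.flow(1), of t s s \<xi>] by (simp add: lin.flow(2))

lemma T_solution: "lin.solution (\<lambda>t. T t s *v \<xi>)"
  by (simp add: T_eq_flow lin.flow(1))

lemma T_self: "T t t *v \<xi> = \<xi>"
  by (simp add: T_eq_flow lin.flow(2))

lemma T_trans: "T t s *v (T s r *v \<xi>) = T t r *v \<xi>"
  by (rule T_apply[OF T_solution])

lemma has_vector_derivative_T: "((\<lambda>t. T t s *v \<xi>) has_vector_derivative A t *v (T t s *v \<xi>)) (at t)"
  using T_solution by (simp add: lin.solution_def)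

lemma norm_T_le: "norm (T t s *v \<xi>) \<le> 2 * lin.weight s t * norm \<xi>"
proof -
  have "norm ((T t s *v \<xi>) - 0) \<le> 2 * lin.weight s t * norm ((T s s *v \<xi>) - 0)"
    by (rule lin.solution_dist_le[OF T_solution]) (simp add: lin.solution_def)
  then show ?thesis
    by (simp add: T_self)
qed

lemma continuous_on_T_left: "continuous_on UNIV (\<lambda>t. T t s *v \<xi>)"
  by (rule lin.continuous_on_solution[OF T_solution])

lemma continuous_on_T_right:
  assumes v: "continuous_on UNIV v"
  shows "continuous_on UNIV (\<lambda>s. T t s *v v s)"
  unfolding continuous_on_eq_continuous_at[OF open_UNIV]
proof
  fix s0 :: real
  define h where "h s = v s - T s s0 *v v s0" for s
  have "continuous_on UNIV h"
    unfolding h_def by (intro continuous_on_diff v continuous_on_T_left)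
  then have "continuous_on UNIV (\<lambda>s. 2 * lin.weight s t * norm (h s))"
    by (intro continuous_intros lin.continuous_on_weight_left)
  then have "isCont (\<lambda>s. 2 * lin.weight s t * norm (h s)) s0"
    by (simp add: continuous_on_eq_continuous_at)
  then have lim: "((\<lambda>s. 2 * lin.weight s t * norm (h s)) \<longlongrightarrow> 0) (at s0)"
    by (simp add: isCont_def h_def T_self)
  have "norm (T t s *v v s - T t s0 *v v s0) \<le> 2 * lin.weight s t * norm (h s)" for s
  proof -
    have "T t s *v v s - T t s0 *v v s0 = T t s *v h s"
      by (simp add: h_def matrix_vector_mult_diff_distrib T_trans)
    then show ?thesis
      using norm_T_le[of t s "h s"] by simp
  qed
  then have "((\<lambda>s. T t s *v v s - T t s0 *v v s0) \<longlongrightarrow> 0) (at s0)"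
    by (intro Lim_null_comparison[OF _ lim] always_eventually) simp
  then show "isCont (\<lambda>s. T t s *v v s) s0"
    by (simp add: isCont_def LIM_zero_cancel)
qed

lemma K_pos: "0 < K" and \<alpha>_pos: "0 < \<alpha>"
  using dich by (auto simp: algebraic_dichotomy_def)

lemma T_P_commute: "T t s *v (P s *v v) = P t *v (T t s *v v)"
  using dich by (simp add: algebraic_dichotomy_def matrix_vector_mul_assoc)

lemma T_Q_commute: "T t s *v ((mat 1 - P s) *v v) = (mat 1 - P t) *v (T t s *v v)"
  by (simp add: matrix_vector_mult_diff_rdistrib matrix_vector_mult_diff_distrib T_P_commute)

lemma norm_T_P_le:
  assumes "s \<le> t"
  shows "norm (T t s *v (P s *v v)) \<le> K * (\<mu> t / \<mu> s) powr (- \<alpha>) * norm v"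
proof -
  have "norm (T t s *v (P s *v v)) \<le> opnorm (T t s ** P s) * norm v"
    using norm_matrix_vector_mult_le_opnorm[of "T t s ** P s" v] by (simp add: matrix_vector_mul_assoc)
  also have "\<dots> \<le> K * (\<mu> t / \<mu> s) powr (- \<alpha>) * norm v"
    using dich assms unfolding algebraic_dichotomy_def by (intro mult_right_mono) auto
  finally show ?thesis .
qed

lemma norm_T_Q_le:
  assumes "t \<le> s"
  shows "norm (T t s *v ((mat 1 - P s) *v v)) \<le> K * (\<mu> s / \<mu> t) powr (- \<alpha>) * norm v"
proof -
  have "norm (T t s *v ((mat 1 - P s) *v v)) \<le> opnorm (T t s ** (mat 1 - P s)) * norm v"
    using norm_matrix_vector_mult_le_opnorm[of "T t s ** (mat 1 - P s)" v] by (simp add: matrix_vector_mul_assoc)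
  also have "\<dots> \<le> K * (\<mu> s / \<mu> t) powr (- \<alpha>) * norm v"
    using dich assms unfolding algebraic_dichotomy_def by (intro mult_right_mono) auto
  finally show ?thesis .
qed

definition rate_bounded :: "real \<Rightarrow> (real \<Rightarrow> real ^ 'n) \<Rightarrow> bool" where
  "rate_bounded c F \<longleftrightarrow> continuous_on UNIV F \<and> 0 \<le> c \<and> (\<forall>s. norm (F s) \<le> c * (deriv \<mu> s / \<mu> s))"

definition green_stable :: "real \<Rightarrow> (real \<Rightarrow> real ^ 'n) \<Rightarrow> real \<Rightarrow> real ^ 'n" where
  "green_stable t F s = T t s *v (P s *v F s)"

definition green_unstable :: "real \<Rightarrow> (real \<Rightarrow> real ^ 'n) \<Rightarrow> real \<Rightarrow> real ^ 'n" where
  "green_unstable t F s = T t s *v ((mat 1 - P s) *v F s)"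

definition green :: "(real \<Rightarrow> real ^ 'n) \<Rightarrow> real \<Rightarrow> real ^ 'n" where
  "green F t = integral {..t} (green_stable t F) - integral {t..} (green_unstable t F)"

lemma continuous_on_green_stable: "continuous_on UNIV F \<Longrightarrow> continuous_on UNIV (green_stable t F)"
  unfolding green_stable_def T_P_commute
  by (rule bounded_linear.continuous_on[OF matrix_vector_mul_bounded_linear continuous_on_T_right])

lemma continuous_on_green_unstable: "continuous_on UNIV F \<Longrightarrow> continuous_on UNIV (green_unstable t F)"
  unfolding green_unstable_def T_Q_commute
  by (rule bounded_linear.continuous_on[OF matrix_vector_mul_bounded_linear continuous_on_T_right])

lemma norm_green_stable_le:
  assumes F: "rate_bounded c F" and "s \<le> t"
  shows "norm (green_stable t F s) \<le> K * c * ((\<mu> t / \<mu> s) powr (- \<alpha>) * (deriv \<mu> s / \<mu> s))"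
proof -
  have "norm (green_stable t F s) \<le> K * (\<mu> t / \<mu> s) powr (- \<alpha>) * norm (F s)"
    unfolding green_stable_def by (rule norm_T_P_le[OF \<open>s \<le> t\<close>])
  also have "\<dots> \<le> K * (\<mu> t / \<mu> s) powr (- \<alpha>) * (c * (deriv \<mu> s / \<mu> s))"
    using F K_pos by (intro mult_left_mono) (auto simp: rate_bounded_def)
  finally show ?thesis
    by (simp add: ac_simps)
qed

lemma norm_green_unstable_le:
  assumes F: "rate_bounded c F" and "t \<le> s"
  shows "norm (green_unstable t F s) \<le> K * c * ((\<mu> s / \<mu> t) powr (- \<alpha>) * (deriv \<mu> s / \<mu> s))"
proof -
  have "norm (green_unstable t F s) \<le> K * (\<mu> s / \<mu> t) powr (- \<alpha>) * norm (F s)"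
    unfolding green_unstable_def by (rule norm_T_Q_le[OF \<open>t \<le> s\<close>])
  also have "\<dots> \<le> K * (\<mu> s / \<mu> t) powr (- \<alpha>) * (c * (deriv \<mu> s / \<mu> s))"
    using F K_pos by (intro mult_left_mono) (auto simp: rate_bounded_def)
  finally show ?thesis
    by (simp add: ac_simps)
qed

lemma has_integral_green_stable_bound:
  "((\<lambda>s. K * c * ((\<mu> t / \<mu> s) powr (- \<alpha>) * (deriv \<mu> s / \<mu> s))) has_integral K * c / \<alpha>) {..t}"
  using has_integral_mult_right[OF growth_rate_has_integral_atMost[OF mu \<alpha>_pos], of "K * c"] by simp

lemma has_integral_green_unstable_bound:
  "((\<lambda>s. K * c * ((\<mu> s / \<mu> t) powr (- \<alpha>) * (deriv \<mu> s / \<mu> s))) has_integral K * c / \<alpha>) {t..}"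
  using has_integral_mult_right[OF growth_rate_has_integral_atLeast[OF mu \<alpha>_pos], of "K * c"] by simp

lemma green_stable_integral_bound:
  assumes F: "rate_bounded c F"
  shows "green_stable t F integrable_on {..t}" "norm (integral {..t} (green_stable t F)) \<le> K * c / \<alpha>"
proof -
  have "continuous_on {..t} (green_stable t F)"
    using F continuous_on_green_stable continuous_on_subset unfolding rate_bounded_def by blast
  moreover have "norm (green_stable t F s) \<le> K * c * ((\<mu> t / \<mu> s) powr (- \<alpha>) * (deriv \<mu> s / \<mu> s))"
    if "s \<in> {..t}" for s
    using norm_green_stable_le[OF F] that by simp
  ultimately show "green_stable t F integrable_on {..t}" "norm (integral {..t} (green_stable t F)) \<le> K * c / \<alpha>"
    using integrable_on_and_norm_integral_le[OF _ _ has_integral_green_stable_bound[where c = c and t = t]] by auto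
qed

lemma green_unstable_integral_bound:
  assumes F: "rate_bounded c F"
  shows "green_unstable t F integrable_on {t..}" "norm (integral {t..} (green_unstable t F)) \<le> K * c / \<alpha>"
proof -
  have "continuous_on {t..} (green_unstable t F)"
    using F continuous_on_green_unstable continuous_on_subset unfolding rate_bounded_def by blast
  moreover have "norm (green_unstable t F s) \<le> K * c * ((\<mu> s / \<mu> t) powr (- \<alpha>) * (deriv \<mu> s / \<mu> s))"
    if "s \<in> {t..}" for s
    using norm_green_unstable_le[OF F] that by simp
  ultimately show "green_unstable t F integrable_on {t..}" "norm (integral {t..} (green_unstable t F)) \<le> K * c / \<alpha>"
    using integrable_on_and_norm_integral_le[OF _ _ has_integral_green_unstable_bound[where c = c and t = t]] by auto
qed

lemma green_stable_integrable:
  assumes F: "rate_bounded c F"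
  shows "green_stable r F integrable_on {..t}"
proof -
  have "green_stable r F = (\<lambda>s. T r t *v green_stable t F s)"
    by (simp add: fun_eq_iff green_stable_def T_trans)
  then show ?thesis
    using integrable_linear[OF green_stable_integral_bound(1)[OF F] matrix_vector_mul_bounded_linear[of "T r t"]]
    by (simp add: o_def)
qed

lemma green_unstable_integrable:
  assumes F: "rate_bounded c F"
  shows "green_unstable r F integrable_on {t..}"
proof -
  have "green_unstable r F = (\<lambda>s. T r t *v green_unstable t F s)"
    by (simp add: fun_eq_iff green_unstable_def T_trans)
  then show ?thesis
    using integrable_linear[OF green_unstable_integral_bound(1)[OF F] matrix_vector_mul_bounded_linear[of "T r t"]]
    by (simp add: o_def)
qed

lemma norm_green_le:
  assumes "rate_bounded c F"
  shows "norm (green F t) \<le> 2 * K * c / \<alpha>"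
proof -
  have "norm (green F t) \<le> norm (integral {..t} (green_stable t F)) + norm (integral {t..} (green_unstable t F))"
    unfolding green_def by (rule norm_triangle_ineq4)
  also have "\<dots> \<le> K * c / \<alpha> + K * c / \<alpha>"
    by (intro add_mono green_stable_integral_bound(2)[OF assms] green_unstable_integral_bound(2)[OF assms])
  finally show ?thesis
    by simp
qed

lemma green_diff:
  assumes "rate_bounded c F" "rate_bounded d G"
  shows "green (\<lambda>s. F s - G s) t = green F t - green G t"
proof -
  have "green_stable t (\<lambda>s. F s - G s) = (\<lambda>s. green_stable t F s - green_stable t G s)"
    and "green_unstable t (\<lambda>s. F s - G s) = (\<lambda>s. green_unstable t F s - green_unstable t G s)"
    by (simp_all add: green_stable_def green_unstable_def matrix_vector_mult_diff_distrib fun_eq_iff)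
  then show ?thesis
    using integral_diff[OF green_stable_integrable[OF assms(1)] green_stable_integrable[OF assms(2)]]
      integral_diff[OF green_unstable_integrable[OF assms(1)] green_unstable_integrable[OF assms(2)]]
    by (simp add: green_def)
qed

lemma has_vector_derivative_green:
  assumes F: "rate_bounded c F"
  shows "(green F has_vector_derivative A t *v green F t + F t) (at t)"
proof -
  txt \<open>Since \<open>T t s = T t 0 ** T 0 s\<close>, the variable \<open>t\<close> can be moved out of the integrands.\<close>
  define g\<^sub>s where "g\<^sub>s = green_stable 0 F"
  define g\<^sub>u where "g\<^sub>u = green_unstable 0 F"
  have stable_eq: "green_stable t F = (\<lambda>s. T t 0 *v g\<^sub>s s)" for t
    by (simp add: fun_eq_iff g\<^sub>s_def green_stable_def T_trans)
  have unstable_eq: "green_unstable t F = (\<lambda>s. T t 0 *v g\<^sub>u s)" for t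
    by (simp add: fun_eq_iff g\<^sub>u_def green_unstable_def T_trans)
  have g_int: "g\<^sub>s integrable_on {..b}" "g\<^sub>u integrable_on {b..}" for b
    unfolding g\<^sub>s_def g\<^sub>u_def by (rule green_stable_integrable[OF F] green_unstable_integrable[OF F])+
  have g_cont: "continuous_on UNIV g\<^sub>s" "continuous_on UNIV g\<^sub>u"
    using F unfolding g\<^sub>s_def g\<^sub>u_def rate_bounded_def
    by (auto intro: continuous_on_green_stable continuous_on_green_unstable)
  define W where "W t = integral {..t} g\<^sub>s - integral {t..} g\<^sub>u" for t
  have green_eq: "green F = (\<lambda>t. T t 0 *v W t)"
    by (simp add: fun_eq_iff green_def W_def stable_eq unstable_eq matrix_vector_mult_diff_distrib
        integral_linear[OF g_int(1) matrix_vector_mul_bounded_linear, unfolded o_def]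
        integral_linear[OF g_int(2) matrix_vector_mul_bounded_linear, unfolded o_def])
  have "(W has_vector_derivative g\<^sub>s t - - g\<^sub>u t) (at t)"
    unfolding W_def
    by (intro has_vector_derivative_diff has_vector_derivative_integral_atMost
        has_vector_derivative_integral_atLeast g_cont g_int)
  moreover have "((\<lambda>t. T t 0 *v \<xi>) has_vector_derivative (A t ** T t 0) *v \<xi>) (at t)" for \<xi>
    using has_vector_derivative_T by (simp add: matrix_vector_mul_assoc)
  ultimately have "((\<lambda>t. T t 0 *v W t) has_vector_derivative
      (A t ** T t 0) *v W t + T t 0 *v (g\<^sub>s t - - g\<^sub>u t)) (at t)"
    by (intro has_vector_derivative_matrix_vector_mult)
  moreover have "T t 0 *v (g\<^sub>s t - - g\<^sub>u t) = F t"
    by (simp add: g\<^sub>s_def g\<^sub>u_def green_stable_def green_unstable_def matrix_vector_mult_diff_rdistrib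
        matrix_vector_mult_diff_distrib T_trans T_self)
  ultimately show ?thesis
    by (simp add: green_eq matrix_vector_mul_assoc)
qed

lemma continuous_on_green: "rate_bounded c F \<Longrightarrow> continuous_on UNIV (green F)"
  by (rule has_vector_derivative_imp_continuous_on[OF has_vector_derivative_green])

lemma integral_green_stable_tendsto:
  assumes Fk: "\<And>k. rate_bounded c (Fk k)" and lim: "\<And>s. (\<lambda>k. Fk k s) \<longlonglongrightarrow> F s"
  shows "(\<lambda>k. integral {..t} (green_stable t (Fk k))) \<longlonglongrightarrow> integral {..t} (green_stable t F)"
proof (rule dominated_convergence(2))
  show "green_stable t (Fk k) integrable_on {..t}" for k
    by (rule green_stable_integrable[OF Fk])
  show "(\<lambda>s. K * c * ((\<mu> t / \<mu> s) powr (- \<alpha>) * (deriv \<mu> s / \<mu> s))) integrable_on {..t}"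
    using has_integral_green_stable_bound by blast
  show "norm (green_stable t (Fk k) s) \<le> K * c * ((\<mu> t / \<mu> s) powr (- \<alpha>) * (deriv \<mu> s / \<mu> s))"
    if "s \<in> {..t}" for k s
    using norm_green_stable_le[OF Fk] that by simp
  show "(\<lambda>k. green_stable t (Fk k) s) \<longlonglongrightarrow> green_stable t F s" for s
    unfolding green_stable_def by (intro bounded_linear.tendsto[OF matrix_vector_mul_bounded_linear] lim)
qed

lemma integral_green_unstable_tendsto:
  assumes Fk: "\<And>k. rate_bounded c (Fk k)" and lim: "\<And>s. (\<lambda>k. Fk k s) \<longlonglongrightarrow> F s"
  shows "(\<lambda>k. integral {t..} (green_unstable t (Fk k))) \<longlonglongrightarrow> integral {t..} (green_unstable t F)"
proof (rule dominated_convergence(2))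
  show "green_unstable t (Fk k) integrable_on {t..}" for k
    by (rule green_unstable_integrable[OF Fk])
  show "(\<lambda>s. K * c * ((\<mu> s / \<mu> t) powr (- \<alpha>) * (deriv \<mu> s / \<mu> s))) integrable_on {t..}"
    using has_integral_green_unstable_bound by blast
  show "norm (green_unstable t (Fk k) s) \<le> K * c * ((\<mu> s / \<mu> t) powr (- \<alpha>) * (deriv \<mu> s / \<mu> s))"
    if "s \<in> {t..}" for k s
    using norm_green_unstable_le[OF Fk] that by simp
  show "(\<lambda>k. green_unstable t (Fk k) s) \<longlonglongrightarrow> green_unstable t F s" for s
    unfolding green_unstable_def by (intro bounded_linear.tendsto[OF matrix_vector_mul_bounded_linear] lim)
qed

lemma green_tendsto:
  assumes "\<And>k. rate_bounded c (Fk k)" and "\<And>s. (\<lambda>k. Fk k s) \<longlonglongrightarrow> F s"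
  shows "(\<lambda>k. green (Fk k) t) \<longlonglongrightarrow> green F t"
  unfolding green_def
  by (intro tendsto_diff integral_green_stable_tendsto[OF assms] integral_green_unstable_tendsto[OF assms])

end

section \<open>The perturbed system\<close>

locale perturbed_system = dichotomic_system A T P \<mu> K \<alpha>
  for A :: "real \<Rightarrow> real ^ 'n ^ 'n" and T P \<mu> K \<alpha> +
  fixes f :: "real \<Rightarrow> real ^ 'n \<Rightarrow> real ^ 'n"
    and \<beta> \<gamma> :: real
  assumes f_cont: "continuous_on UNIV (\<lambda>(t, x). f t x)"
    and \<beta>: "0 \<le> \<beta>" and \<gamma>: "0 \<le> \<gamma>"
    and f_bdd: "\<And>t x. norm (f t x) \<le> \<beta> * deriv \<mu> t / \<mu> t"
    and f_lip: "\<And>t x1 x2. norm (f t x1 - f t x2) \<le> \<gamma> * deriv \<mu> t / \<mu> t * norm (x1 - x2)"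
    and small: "2 * K * \<gamma> / \<alpha> < 1"
begin

lemma norm_A_f_diff_le:
  "norm (A t *v x + f t x - (A t *v y + f t y)) \<le> (M + (\<beta> + \<gamma>) * (deriv \<mu> t / \<mu> t)) * norm (x - y)"
proof -
  have "norm (A t *v x + f t x - (A t *v y + f t y)) \<le> norm (A t *v (x - y)) + norm (f t x - f t y)"
    by (metis add_diff_add matrix_vector_mult_diff_distrib norm_triangle_ineq)
  also have "\<dots> \<le> M * norm (x - y) + (\<beta> + \<gamma>) * (deriv \<mu> t / \<mu> t) * norm (x - y)"
  proof (rule add_mono)
    show "norm (A t *v (x - y)) \<le> M * norm (x - y)"
      by (rule norm_A_mult_le)
    have "norm (f t x - f t y) \<le> \<gamma> * (deriv \<mu> t / \<mu> t) * norm (x - y)"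
      using f_lip[of t x y] by simp
    also have "\<dots> \<le> (\<beta> + \<gamma>) * (deriv \<mu> t / \<mu> t) * norm (x - y)"
      using \<beta> growth_rate_logderiv_nonneg[OF mu, of t] by (intro mult_right_mono) auto
    finally show "norm (f t x - f t y) \<le> (\<beta> + \<gamma>) * (deriv \<mu> t / \<mu> t) * norm (x - y)" .
  qed
  finally show ?thesis
    by (simp add: algebra_simps)
qed

lemma norm_A_f_zero_le: "norm (A t *v 0 + f t 0) \<le> M + (\<beta> + \<gamma>) * (deriv \<mu> t / \<mu> t)"
  using f_bdd[of t 0] M_nonneg \<gamma> growth_rate_logderiv_nonneg[OF mu, of t]
    mult_right_mono[of \<beta> "\<beta> + \<gamma>" "deriv \<mu> t / \<mu> t"]
  by simp

sublocale nl: lipschitz_ode "\<lambda>t x. A t *v x + f t x" "\<lambda>t. M + (\<beta> + \<gamma>) * (deriv \<mu> t / \<mu> t)"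
  "\<lambda>t. M * t + (\<beta> + \<gamma>) * ln (\<mu> t)"
proof
  show "continuous_on UNIV (\<lambda>(t, x). A t *v x + f t x)"
    using continuous_on_add[OF continuous_on_matrix_vector_mult_Pair[OF A_cont] f_cont]
    by (simp add: case_prod_unfold)
  show "0 \<le> M + (\<beta> + \<gamma>) * (deriv \<mu> t / \<mu> t)" for t
    using M_nonneg \<beta> \<gamma> growth_rate_logderiv_nonneg[OF mu, of t]
    by (intro add_nonneg_nonneg mult_nonneg_nonneg) auto
  show "((\<lambda>t. M * t + (\<beta> + \<gamma>) * ln (\<mu> t)) has_real_derivative M + (\<beta> + \<gamma>) * (deriv \<mu> t / \<mu> t)) (at t)" for t
    using growth_rate_pos[OF mu, of t]
    by (auto intro!: derivative_eq_intros growth_rate_has_derivative[OF mu] simp: field_simps)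
qed (rule norm_A_f_diff_le norm_A_f_zero_le)+

lemma nl_solution_iff: "nl.solution x \<longleftrightarrow> nonlin_solution A f x"
  by (simp add: nl.solution_def nonlin_solution_def)

lemma rate_bounded_f: "continuous_on UNIV x \<Longrightarrow> rate_bounded \<beta> (\<lambda>s. f s (x s))"
  unfolding rate_bounded_def using continuous_on_UNIV_compose_Pair[OF f_cont] \<beta> f_bdd by simp

definition correction_map :: "(real \<Rightarrow> real ^ 'n) \<Rightarrow> (real \<Rightarrow>\<^sub>C (real ^ 'n)) \<Rightarrow> (real \<Rightarrow>\<^sub>C (real ^ 'n))" where
  "correction_map y z = Bcontfun (green (\<lambda>s. f s (y s + apply_bcontfun z s)))"

lemma rate_bounded_f_shift:
  "continuous_on UNIV y \<Longrightarrow> rate_bounded \<beta> (\<lambda>s. f s (y s + apply_bcontfun z s))"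
  by (intro rate_bounded_f continuous_intros continuous_on_apply_bcontfun)

lemma apply_correction_map:
  assumes y: "continuous_on UNIV y"
  shows "apply_bcontfun (correction_map y z) = green (\<lambda>s. f s (y s + apply_bcontfun z s))"
proof -
  have "green (\<lambda>s. f s (y s + apply_bcontfun z s)) \<in> bcontfun"
    using continuous_on_green norm_green_le rate_bounded_f_shift[OF y] by (intro bcontfun_normI) blast+
  then show ?thesis
    by (simp add: correction_map_def Bcontfun_inverse)
qed

lemma dist_correction_map_le:
  assumes y: "continuous_on UNIV y"
  shows "dist (correction_map y z\<^sub>1) (correction_map y z\<^sub>2) \<le> 2 * K * \<gamma> / \<alpha> * dist z\<^sub>1 z\<^sub>2"
proof (rule dist_bound)
  fix t
  let ?F\<^sub>1 = "\<lambda>s. f s (y s + apply_bcontfun z\<^sub>1 s)" and ?F\<^sub>2 = "\<lambda>s. f s (y s + apply_bcontfun z\<^sub>2 s)"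
  have "rate_bounded (\<gamma> * dist z\<^sub>1 z\<^sub>2) (\<lambda>s. ?F\<^sub>1 s - ?F\<^sub>2 s)"
    unfolding rate_bounded_def
  proof (intro conjI allI)
    show "continuous_on UNIV (\<lambda>s. ?F\<^sub>1 s - ?F\<^sub>2 s)"
      using rate_bounded_f_shift[OF y] by (intro continuous_on_diff) (auto simp: rate_bounded_def)
    show "0 \<le> \<gamma> * dist z\<^sub>1 z\<^sub>2"
      using \<gamma> by simp
    fix s
    have "norm (?F\<^sub>1 s - ?F\<^sub>2 s) \<le> \<gamma> * (deriv \<mu> s / \<mu> s) * norm (apply_bcontfun z\<^sub>1 s - apply_bcontfun z\<^sub>2 s)"
      using f_lip[of s "y s + apply_bcontfun z\<^sub>1 s" "y s + apply_bcontfun z\<^sub>2 s"] by simp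
    also have "\<dots> \<le> \<gamma> * (deriv \<mu> s / \<mu> s) * dist z\<^sub>1 z\<^sub>2"
      using dist_bounded[of z\<^sub>1 s z\<^sub>2] mult_nonneg_nonneg[OF \<gamma> growth_rate_logderiv_nonneg[OF mu, of s]]
      by (intro mult_left_mono) (auto simp: dist_norm)
    finally show "norm (?F\<^sub>1 s - ?F\<^sub>2 s) \<le> \<gamma> * dist z\<^sub>1 z\<^sub>2 * (deriv \<mu> s / \<mu> s)"
      by (simp add: ac_simps)
  qed
  then have "norm (green (\<lambda>s. ?F\<^sub>1 s - ?F\<^sub>2 s) t) \<le> 2 * K * (\<gamma> * dist z\<^sub>1 z\<^sub>2) / \<alpha>"
    by (rule norm_green_le)
  then show "dist (correction_map y z\<^sub>1 t) (correction_map y z\<^sub>2 t) \<le> 2 * K * \<gamma> / \<alpha> * dist z\<^sub>1 z\<^sub>2"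
    by (simp add: apply_correction_map[OF y] dist_norm green_diff[OF rate_bounded_f_shift[OF y] rate_bounded_f_shift[OF y]])
qed

lemma correction_map_unique_fixed_point: "continuous_on UNIV y \<Longrightarrow> \<exists>!z. correction_map y z = z"
  using K_pos \<alpha>_pos \<gamma> small
  by (intro banach_fix_type[of "2 * K * \<gamma> / \<alpha>"] allI dist_correction_map_le) auto

text \<open>For a solution \<open>y\<close> of the linear system, \<open>y + correction y\<close> is the solution of the perturbed
  system at bounded distance from \<open>y\<close>.\<close>

definition correction :: "(real \<Rightarrow> real ^ 'n) \<Rightarrow> real \<Rightarrow> real ^ 'n" where
  "correction y = apply_bcontfun (THE z. correction_map y z = z)"

lemma correction_eq:
  assumes y: "continuous_on UNIV y"
  shows "correction y = green (\<lambda>s. f s (y s + correction y s))"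
proof -
  define z where "z = (THE z. correction_map y z = z)"
  have "correction_map y z = z"
    unfolding z_def by (rule theI'[OF correction_map_unique_fixed_point[OF y]])
  then have "apply_bcontfun z = green (\<lambda>s. f s (y s + apply_bcontfun z s))"
    using apply_correction_map[OF y, of z] by simp
  then show ?thesis
    by (simp add: correction_def z_def[symmetric])
qed

lemma correction_unique:
  assumes y: "continuous_on UNIV y" and z: "continuous_on UNIV z" "\<And>t. norm (z t) \<le> B"
    and fixed: "z = green (\<lambda>s. f s (y s + z s))"
  shows "correction y = z"
proof -
  have z_bcontfun: "z \<in> bcontfun"
    by (rule bcontfun_normI[OF z])
  have "correction_map y (Bcontfun z) = Bcontfun z"
    by (rule bcontfun_eqI) (simp add: apply_correction_map[OF y] Bcontfun_inverse[OF z_bcontfun] fixed[symmetric])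
  then have "(THE z. correction_map y z = z) = Bcontfun z"
    by (rule the1_equality[OF correction_map_unique_fixed_point[OF y]])
  then show ?thesis
    using z_bcontfun by (simp add: correction_def Bcontfun_inverse)
qed

lemma continuous_on_correction: "continuous_on UNIV (correction y)"
  unfolding correction_def by (rule continuous_on_apply_bcontfun)

lemma norm_correction_le:
  assumes y: "continuous_on UNIV y"
  shows "norm (correction y t) \<le> 2 * K * \<beta> / \<alpha>"
proof -
  have "correction y t = green (\<lambda>s. f s (y s + correction y s)) t"
    using correction_eq[OF y] by (rule fun_cong)
  also have "norm \<dots> \<le> 2 * K * \<beta> / \<alpha>"
    by (intro norm_green_le rate_bounded_f continuous_on_add y continuous_on_correction)
  finally show ?thesis .
qed

definition H :: "real \<Rightarrow> real ^ 'n \<Rightarrow> real ^ 'n" where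
  "H t \<xi> = \<xi> - green (\<lambda>s. f s (nl.flow t \<xi> s)) t"

definition G :: "real \<Rightarrow> real ^ 'n \<Rightarrow> real ^ 'n" where
  "G t \<eta> = \<eta> + correction (\<lambda>s. T s t *v \<eta>) t"

lemma norm_H_le: "norm (H t \<xi> - \<xi>) \<le> 2 * K * \<beta> / \<alpha>"
  using norm_green_le[OF rate_bounded_f[OF nl.continuous_on_solution[OF nl.flow(1)]]]
  by (simp add: H_def)

lemma norm_G_le: "norm (G t \<eta> - \<eta>) \<le> 2 * K * \<beta> / \<alpha>"
  using norm_correction_le[OF continuous_on_T_left] by (simp add: G_def)

lemma H_along: "nl.solution x \<Longrightarrow> H t (x t) = x t - green (\<lambda>s. f s (x s)) t"
  by (simp add: H_def nl.flow_eq)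

lemma G_along: "lin.solution y \<Longrightarrow> G t (y t) = y t + correction y t"
  by (simp add: G_def T_apply)

lemma lin_solution_H:
  assumes x: "nl.solution x"
  shows "lin.solution (\<lambda>t. H t (x t))"
  unfolding lin.solution_def
proof
  fix t
  have "(x has_vector_derivative A t *v x t + f t (x t)) (at t)"
    using x by (simp add: nl.solution_def)
  moreover have "(green (\<lambda>s. f s (x s)) has_vector_derivative A t *v green (\<lambda>s. f s (x s)) t + f t (x t)) (at t)"
    by (rule has_vector_derivative_green[OF rate_bounded_f[OF nl.continuous_on_solution[OF x]]])
  ultimately have "((\<lambda>t. x t - green (\<lambda>s. f s (x s)) t) has_vector_derivative
      (A t *v x t + f t (x t)) - (A t *v green (\<lambda>s. f s (x s)) t + f t (x t))) (at t)"
    by (rule has_vector_derivative_diff)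
  then show "((\<lambda>t. H t (x t)) has_vector_derivative A t *v H t (x t)) (at t)"
    by (simp add: H_along[OF x] matrix_vector_mult_diff_distrib)
qed

lemma nl_solution_G:
  assumes y: "lin.solution y"
  shows "nl.solution (\<lambda>t. G t (y t))"
  unfolding nl.solution_def
proof
  fix t
  have y_cont: "continuous_on UNIV y"
    by (rule lin.continuous_on_solution[OF y])
  have "(correction y has_vector_derivative A t *v correction y t + f t (y t + correction y t)) (at t)"
    using has_vector_derivative_green[OF rate_bounded_f[OF continuous_on_add[OF y_cont continuous_on_correction[of y]]]]
    by (simp flip: correction_eq[OF y_cont])
  then have "((\<lambda>t. y t + correction y t) has_vector_derivative
      A t *v y t + (A t *v correction y t + f t (y t + correction y t))) (at t)"
    using y unfolding lin.solution_def by (intro has_vector_derivative_add) auto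
  then show "((\<lambda>t. G t (y t)) has_vector_derivative A t *v G t (y t) + f t (G t (y t))) (at t)"
    by (simp add: G_along[OF y] matrix_vector_right_distrib add.assoc)
qed

lemma G_H: "G t (H t \<xi>) = \<xi>"
proof -
  define x where "x = nl.flow t \<xi>"
  have x: "nl.solution x"
    unfolding x_def by (rule nl.flow(1))
  define y where "y s = H s (x s)" for s
  have y: "lin.solution y"
    unfolding y_def by (rule lin_solution_H[OF x])
  have "correction y = (\<lambda>s. x s - y s)"
  proof (rule correction_unique)
    show "continuous_on UNIV y" "continuous_on UNIV (\<lambda>s. x s - y s)"
      using lin.continuous_on_solution[OF y] nl.continuous_on_solution[OF x] by (auto intro: continuous_on_diff)
    show "norm (x s - y s) \<le> 2 * K * \<beta> / \<alpha>" for s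
      using norm_H_le[of s "x s"] by (simp add: y_def norm_minus_commute)
    show "(\<lambda>s. x s - y s) = green (\<lambda>s. f s (y s + (x s - y s)))"
      by (simp add: y_def H_along[OF x] fun_eq_iff)
  qed
  then have "G t (y t) = x t"
    by (simp add: G_along[OF y])
  then show ?thesis
    by (simp add: y_def x_def nl.flow(2))
qed

lemma H_G: "H t (G t \<eta>) = \<eta>"
proof -
  define y where "y s = T s t *v \<eta>" for s
  have y: "lin.solution y"
    unfolding y_def by (rule T_solution)
  define x where "x s = G s (y s)" for s
  have x: "nl.solution x"
    unfolding x_def by (rule nl_solution_G[OF y])
  have x_eq: "x = (\<lambda>s. y s + correction y s)"
    by (simp add: fun_eq_iff x_def G_along[OF y])
  have "H t (x t) = x t - green (\<lambda>s. f s (x s)) t"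
    by (rule H_along[OF x])
  also have "\<dots> = y t"
    using fun_cong[OF correction_eq[OF lin.continuous_on_solution[OF y]], of t] by (simp add: x_eq)
  finally have "H t (x t) = y t" .
  then show ?thesis
    by (simp add: x_def y_def T_self)
qed

lemma continuous_on_H: "continuous_on UNIV (H t)"
proof (rule continuous_on_sequentiallyI)
  fix \<xi>s :: "nat \<Rightarrow> real ^ 'n" and \<xi> assume lim: "\<xi>s \<longlonglongrightarrow> \<xi>"
  have f_cont_slice: "continuous_on UNIV (f s)" for s
    using continuous_on_compose2[OF f_cont continuous_on_Pair[OF continuous_on_const continuous_on_id]]
    by (simp add: case_prod_unfold)
  have bounded: "rate_bounded \<beta> (\<lambda>s. f s (nl.flow t \<eta> s))" for \<eta>
    by (rule rate_bounded_f[OF nl.continuous_on_solution[OF nl.flow(1)]])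
  have "(\<lambda>k. green (\<lambda>s. f s (nl.flow t (\<xi>s k) s)) t) \<longlonglongrightarrow> green (\<lambda>s. f s (nl.flow t \<xi> s)) t"
  proof (rule green_tendsto[OF bounded])
    show "(\<lambda>k. f s (nl.flow t (\<xi>s k) s)) \<longlonglongrightarrow> f s (nl.flow t \<xi> s)" for s
      by (rule continuous_on_tendsto_compose[OF f_cont_slice nl.flow_tendsto[OF lim]]) auto
  qed
  then show "(\<lambda>k. H t (\<xi>s k)) \<longlonglongrightarrow> H t \<xi>"
    unfolding H_def by (intro tendsto_diff lim)
qed

lemma homeomorphism_H_G: "homeomorphism UNIV UNIV (H t) (G t)"
proof -
  have "inj (H t)"
    by (rule inj_on_inverseI[of _ "G t"]) (rule G_H)
  then obtain G' where G': "homeomorphism UNIV (range (H t)) (H t) G'"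
    using invariance_of_domain_homeomorphism[OF open_UNIV continuous_on_H] by auto
  have "range (H t) = UNIV"
    by (rule surjI[of _ "G t"]) (rule H_G)
  moreover have "G' = G t"
  proof
    show "G' \<eta> = G t \<eta>" for \<eta>
      using G' homeomorphism_apply1[OF G', of "G t \<eta>"] by (simp add: H_G)
  qed
  ultimately show ?thesis
    using G' by simp
qed

end

theorem theorem2p1:
  fixes A :: "real \<Rightarrow> real ^ 'n ^ 'n"
    and T :: "real \<Rightarrow> real \<Rightarrow> real ^ 'n ^ 'n"
    and P :: "real \<Rightarrow> real ^ 'n ^ 'n"
    and \<mu> :: "real \<Rightarrow> real"
    and f :: "real \<Rightarrow> real ^ 'n \<Rightarrow> real ^ 'n"
    and K \<alpha> \<beta> \<gamma> :: real
  assumes A_cont: "continuous_on UNIV A"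
    and A_bdd: "bounded (range A)"
    and mu: "growth_rate \<mu>"
    and T: "evolution_operator A T"
    and dich: "algebraic_dichotomy T \<mu> P K \<alpha>"
    and f_cont: "continuous_on UNIV (\<lambda>(t, x). f t x)"
    and \<beta>: "\<beta> \<ge> 0" and \<gamma>: "\<gamma> \<ge> 0"
    and f_bdd: "\<And>t x. norm (f t x) \<le> \<beta> * deriv \<mu> t / \<mu> t"
    and f_lip: "\<And>t x1 x2. norm (f t x1 - f t x2) \<le> \<gamma> * deriv \<mu> t / \<mu> t * norm (x1 - x2)"
    and small: "6 * K * \<gamma> / \<alpha> < 1"
  shows "\<exists>H G :: real \<Rightarrow> real ^ 'n \<Rightarrow> real ^ 'n.
           (\<forall>t. homeomorphism UNIV UNIV (H t) (G t))
         \<and> (\<forall>t x. norm (H t x - x) \<le> 2 * K * \<beta> / \<alpha>)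
         \<and> (\<forall>t y. norm (G t y - y) \<le> 2 * K * \<beta> / \<alpha>)
         \<and> (\<forall>x. nonlin_solution A f x \<longrightarrow> lin_solution A (\<lambda>t. H t (x t)))
         \<and> (\<forall>y. lin_solution A y \<longrightarrow> nonlin_solution A f (\<lambda>t. G t (y t)))"
proof -
  txt \<open>The argument only needs \<open>2 * K * \<gamma> / \<alpha> < 1\<close>.\<close>
  have "2 * K * \<gamma> / \<alpha> \<le> 6 * K * \<gamma> / \<alpha>"
    using dich \<gamma> by (intro divide_right_mono) (auto simp: algebraic_dichotomy_def)
  with small have small': "2 * K * \<gamma> / \<alpha> < 1"
    by linarith
  interpret perturbed_system A T P \<mu> K \<alpha> f \<beta> \<gamma>
    by unfold_locales (fact A_cont A_bdd mu T dich f_cont \<beta> \<gamma> f_bdd f_lip small')+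
  show ?thesis
    using lin_solution_H nl_solution_G
    by (intro exI[of _ H] exI[of _ G] conjI allI impI homeomorphism_H_G norm_H_le norm_G_le)
      (simp_all add: lin_solution_iff nl_solution_iff)
qed

end
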